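(* Suppose $\lambda=\mu^+$ for $\mu$ a strong limit singular cardinal, and let $(\bar C,\bar I)$ be an $S$-fair pair for some stationary $S\subseteq\{\delta<\lambda:\mathrm{cf}(\delta)=\mathrm{cf}(\mu)\}$. If $\mathrm{id}_p(\bar C,\bar I)$ is weakly $\mu$-saturated, then every stationary subset of $\{\delta<\lambda:\mathrm{cf}(\delta)\neq\mathrm{cf}(\mu)\}$ reflects.
   Context: For a closed set $C$, $\mathrm{nacc}(C)=\{\alpha\in C:\sup(C\cap\alpha)<\alpha\}$, $\mathrm{acc}(C)=C\setminus\mathrm{nacc}(C)$. An $S$-fair pair is $(\bar C,\bar I)$ where $\bar C=\langle C_\delta:\delta\in S\rangle$ with each $C_\delta$ closed unbounded in $\delta$; $\bar I=\langle I_\delta:\delta\in S\rangle$ with $I_\delta$ the ideal on $C_\delta$ generated by the sets $\{\gamma\in C_\delta:\gamma\in\mathrm{acc}(C_\delta)\text{ or }\mathrm{cf}(\gamma)<\alpha\text{ or }\gamma<\beta\}$ for $\alpha<\mu$, $\beta<\delta$; and for every club $E\subseteq\lambda$, $\{\delta\in S:E\cap C_\delta\notin I_\delta\}$ is stationary. $\mathrm{id}_p(\bar C,\bar I)$ is the ideal of all $A\subseteq\lambda$ such that for some club $E\subseteq\lambda$, $E\cap A\cap C_\delta\in I_\delta$ for all $\delta\in S\cap E$. An ideal $I$ on $A$ is weakly $\sigma$-saturated if $A$ cannot be partitioned into $\sigma$ pairwise disjoint sets none of which is in $I$. A stationary $T\subseteq\lambda$ reflects if there is $\gamma<\lambda$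 of uncountable cofinality with $T\cap\gamma$ stationary in $\gamma$. *)

theory Defs
  imports Main "HOL-Library.Disjoint_Sets" "HOL-Library.Countable_Set"
begin

unbundle cardinal_syntax

text \<open>
  The ordinals below \<open>\<lambda>\<close> are the elements of a well-ordered type \<open>'a\<close>; an ordinal
  \<open>\<alpha> < \<lambda>\<close>, regarded as a set, is \<open>{..<\<alpha>}\<close>, and \<open>\<lambda>\<close> itself is \<open>UNIV\<close>.
\<close>

definition is_cardinal :: "'a::wellorder \<Rightarrow> bool" where
  "is_cardinal \<kappa> \<longleftrightarrow> (\<forall>\<alpha><\<kappa>. |{..<\<alpha>}| <o |{..<\<kappa>}| )"

text \<open>The order type of the whole type is the initial ordinal \<open>\<mu>\<^sup>+\<close>.\<close>

definition type_is_successor_cardinal :: "'a::wellorder \<Rightarrow> bool" where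
  "type_is_successor_cardinal \<mu> \<longleftrightarrow>
     is_cardinal \<mu> \<and> {(x, y :: 'a). x \<le> y} =o cardSuc |{..<\<mu>}|"

definition cof :: "'a::wellorder \<Rightarrow> 'a" where
  "cof \<gamma> = (LEAST \<kappa>. \<exists>f :: 'a \<Rightarrow> 'a. f ` {..<\<kappa>} \<subseteq> {..<\<gamma>} \<and> (\<forall>x<\<gamma>. \<exists>i<\<kappa>. x \<le> f i))"

definition singular_cardinal :: "'a::wellorder \<Rightarrow> bool" where
  "singular_cardinal \<mu> \<longleftrightarrow> is_cardinal \<mu> \<and> infinite {..<\<mu>} \<and> cof \<mu> < \<mu>"

definition strong_limit_cardinal :: "'a::wellorder \<Rightarrow> bool" where
  "strong_limit_cardinal \<mu> \<longleftrightarrow>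
     is_cardinal \<mu> \<and> infinite {..<\<mu>} \<and> (\<forall>\<kappa><\<mu>. |Pow {..<\<kappa>}| <o |{..<\<mu>}| )"

text \<open>
  Below, \<open>D\<close> is an initial segment (\<open>UNIV\<close> or \<open>{..<\<delta>}\<close>) standing for an ordinal. In the
  closure clause, the condition on \<open>\<alpha>\<close> says that \<open>\<alpha>\<close> is a limit point of \<open>E\<close>; nonemptiness
  of \<open>E \<inter> {..<\<alpha>}\<close> is needed to exclude \<open>\<alpha> = 0\<close>.
\<close>

definition club_in :: "'a::wellorder set \<Rightarrow> 'a set \<Rightarrow> bool" where
  "club_in E D \<longleftrightarrow>
     E \<subseteq> D \<and>
     (\<forall>x\<in>D. \<exists>e\<in>E. x \<le> e) \<and>
     (\<forall>\<alpha>\<in>D. E \<inter> {..<\<alpha>} \<noteq> {} \<and> (\<forall>x<\<alpha>. \<exists>e\<in>E. x < e \<and> e < \<alpha>) \<longrightarrow> \<alpha> \<in> E)"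

definition stationary_in :: "'a::wellorder set \<Rightarrow> 'a set \<Rightarrow> bool" where
  "stationary_in T D \<longleftrightarrow> T \<subseteq> D \<and> (\<forall>E. club_in E D \<longrightarrow> T \<inter> E \<noteq> {})"

definition reflects :: "'a::wellorder set \<Rightarrow> bool" where
  "reflects T \<longleftrightarrow> (\<exists>\<gamma>. uncountable {..<cof \<gamma>} \<and> stationary_in (T \<inter> {..<\<gamma>}) {..<\<gamma>})"

text \<open>Supremum of a set of ordinals bounded in the type; \<open>osup {}\<close> is the least element.\<close>

definition osup :: "'a::wellorder set \<Rightarrow> 'a" where
  "osup A = (LEAST \<beta>. \<forall>x\<in>A. x \<le> \<beta>)"

definition nacc :: "'a::wellorder set \<Rightarrow> 'a set" where
  "nacc C = {\<alpha>\<in>C. osup (C \<inter> {..<\<alpha>}) < \<alpha>}"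

definition acc :: "'a::wellorder set \<Rightarrow> 'a set" where
  "acc C = C - nacc C"

text \<open>Ideals are not required to be proper.\<close>

definition ideal_on :: "'b set \<Rightarrow> 'b set set \<Rightarrow> bool" where
  "ideal_on X J \<longleftrightarrow>
     J \<subseteq> Pow X \<and> {} \<in> J \<and>
     (\<forall>A B. B \<in> J \<and> A \<subseteq> B \<longrightarrow> A \<in> J) \<and>
     (\<forall>A\<in>J. \<forall>B\<in>J. A \<union> B \<in> J)"

definition generated_ideal :: "'b set \<Rightarrow> 'b set set \<Rightarrow> 'b set set" where
  "generated_ideal X G = \<Inter>{J. ideal_on X J \<and> G \<subseteq> J}"

definition fair_pair ::
  "'a::wellorder \<Rightarrow> 'a set \<Rightarrow> ('a \<Rightarrow> 'a set) \<Rightarrow> ('a \<Rightarrow> 'a set set) \<Rightarrow> bool" where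
  "fair_pair \<mu> S C I \<longleftrightarrow>
     (\<forall>\<delta>\<in>S. club_in (C \<delta>) {..<\<delta>}) \<and>
     (\<forall>\<delta>\<in>S. I \<delta> = generated_ideal (C \<delta>)
        {{\<gamma> \<in> C \<delta>. \<gamma> \<in> acc (C \<delta>) \<or> cof \<gamma> < \<alpha> \<or> \<gamma> < \<beta>} |\<alpha> \<beta>. \<alpha> < \<mu> \<and> \<beta> < \<delta>}) \<and>
     (\<forall>E. club_in E UNIV \<longrightarrow> stationary_in {\<delta>\<in>S. E \<inter> C \<delta> \<notin> I \<delta>} UNIV)"

definition id_p ::
  "'a::wellorder set \<Rightarrow> ('a \<Rightarrow> 'a set) \<Rightarrow> ('a \<Rightarrow> 'a set set) \<Rightarrow> 'a set set" where
  "id_p S C I = {A. \<exists>E. club_in E UNIV \<and> (\<forall>\<delta>\<in>S \<inter> E. E \<inter> A \<inter> C \<delta> \<in> I \<delta>)}"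

definition weakly_saturated :: "'a::wellorder \<Rightarrow> 'b set \<Rightarrow> 'b set set \<Rightarrow> bool" where
  "weakly_saturated \<sigma> X J \<longleftrightarrow>
     \<not> (\<exists>P. partition_on X P \<and> |P| =o |{..<\<sigma>}| \<and> (\<forall>A\<in>P. A \<notin> J))"

end

theory Submission
  imports Defs
begin

text \<open>
  Suppose \<open>T\<close> does not reflect. Then every limit \<open>\<gamma>\<close> carries a club \<open>c \<gamma>\<close> of \<open>\<gamma>\<close> missing the limit
  points in \<open>T\<close>, and by induction on \<open>\<beta>\<close> there are regressive \<open>F \<beta>\<close> making the tails of \<open>c \<delta>\<close>
  above \<open>F \<beta> \<delta>\<close>, for \<open>\<delta> \<in> T\<close> below \<open>\<beta>\<close>, pairwise disjoint. Since \<open>I \<epsilon>\<close> is governed by pairs in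
  \<open>\<mu> \<times> \<epsilon>\<close>, both of cofinality \<open>cf \<mu>\<close>, the ideal \<open>id_p\<close> is closed under increasing unions
  of length \<open>\<delta>\<close> whenever \<open>cf \<delta> \<noteq> cf \<mu>\<close>. Hence for \<open>\<delta> \<in> T\<close> some \<open>\<eta> \<delta> < \<delta>\<close> makes
  \<open>B \<delta> = {\<beta> > \<delta>. F \<beta> \<delta> \<le> \<eta> \<delta>}\<close> positive. Pick \<open>\<alpha> \<delta> \<in> c \<delta>\<close> above \<open>\<eta> \<delta>\<close> and press down: among
  the unboundedly many \<open>\<delta>\<close> with the same \<open>\<alpha> \<delta>\<close> the sets \<open>B \<delta>\<close> are pairwise disjoint, since
  \<open>\<beta> \<in> B \<delta> \<inter> B \<delta>'\<close> would put the common value into two disjoint tails. This contradicts weak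
  saturation.
\<close>

section \<open>Cofinality, and clubs in a limit ordinal that avoid a nonreflecting set\<close>

definition limit_ord :: "'a::wellorder \<Rightarrow> bool" where
  "limit_ord \<delta> \<longleftrightarrow> (\<exists>x. x < \<delta>) \<and> (\<forall>x<\<delta>. \<exists>y<\<delta>. x < y)"

lemma cof_cofinal:
  fixes \<gamma> :: "'a::wellorder"
  shows "\<exists>f :: 'a \<Rightarrow> 'a. (\<forall>i<cof \<gamma>. f i < \<gamma>) \<and> (\<forall>x<\<gamma>. \<exists>i<cof \<gamma>. x \<le> f i)"
proof -
  let ?P = "\<lambda>\<kappa>. \<exists>f :: 'a \<Rightarrow> 'a. f ` {..<\<kappa>} \<subseteq> {..<\<gamma>} \<and> (\<forall>x<\<gamma>. \<exists>i<\<kappa>. x \<le> f i)"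
  have "?P \<gamma>" by (rule exI[of _ id]) auto
  then have "?P (cof \<gamma>)" unfolding cof_def by (rule LeastI)
  then show ?thesis by (auto simp: image_subset_iff)
qed

lemma less_cof_bounded:
  fixes \<gamma> :: "'a::wellorder"
  assumes "\<kappa> < cof \<gamma>" "\<And>i. i < \<kappa> \<Longrightarrow> f i < \<gamma>"
  shows "\<exists>x<\<gamma>. \<forall>i<\<kappa>. f i < x"
proof -
  have "\<not> (\<exists>f :: 'a \<Rightarrow> 'a. f ` {..<\<kappa>} \<subseteq> {..<\<gamma>} \<and> (\<forall>x<\<gamma>. \<exists>i<\<kappa>. x \<le> f i))"
    using assms(1) unfolding cof_def by (rule not_less_Least)
  then have "\<not> (\<forall>x<\<gamma>. \<exists>i<\<kappa>. x \<le> f i)" using assms(2) by blast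
  then show ?thesis by (meson not_le)
qed

text \<open>If no \<open>b\<close> worked, each \<open>b < \<rho>\<close> would have a point
  \<open>\<psi> b < \<delta>\<close> from which on \<open>\<phi>\<close> exceeds \<open>b\<close>.
  Sending a cofinal sequence of the ordinal with smaller cofinality through \<open>\<phi>\<close> or
  \<open>\<psi>\<close> gives a family bounded in the other ordinal, and that bound refutes the
  choice of \<open>\<psi>\<close>.\<close>

lemma cof_neq_bounded_cofinally:
  fixes \<delta> \<rho> :: "'a::wellorder"
  assumes ne: "cof \<delta> \<noteq> cof \<rho>" and \<phi>: "\<And>\<eta>. \<eta> < \<delta> \<Longrightarrow> \<phi> \<eta> < \<rho>"
  shows "\<exists>b<\<rho>. \<forall>x<\<delta>. \<exists>\<eta><\<delta>. x \<le> \<eta> \<and> \<phi> \<eta> \<le> b"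
proof (rule ccontr)
  assume "\<not> ?thesis"
  then have "\<forall>b<\<rho>. \<exists>x<\<delta>. \<forall>\<eta><\<delta>. x \<le> \<eta> \<longrightarrow> b < \<phi> \<eta>" by (meson not_le)
  then obtain \<psi> where \<psi>: "\<And>b. b < \<rho> \<Longrightarrow> \<psi> b < \<delta>"
    "\<And>b \<eta>. b < \<rho> \<Longrightarrow> \<eta> < \<delta> \<Longrightarrow> \<psi> b \<le> \<eta> \<Longrightarrow> b < \<phi> \<eta>" by metis
  obtain f where f: "\<And>i. i < cof \<delta> \<Longrightarrow> f i < \<delta>" "\<And>x. x < \<delta> \<Longrightarrow> \<exists>i<cof \<delta>. x \<le> f i"
    using cof_cofinal[of \<delta>] by blast
  obtain g where g: "\<And>i. i < cof \<rho> \<Longrightarrow> g i < \<rho>" "\<And>x. x < \<rho> \<Longrightarrow> \<exists>i<cof \<rho>. x \<le> g i"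
    using cof_cofinal[of \<rho>] by blast
  consider "cof \<delta> < cof \<rho>" | "cof \<rho> < cof \<delta>" using ne by fastforce
  then show False
  proof cases
    case 1
    then obtain b where "b < \<rho>" "\<And>i. i < cof \<delta> \<Longrightarrow> \<phi> (f i) < b"
      using less_cof_bounded[of "cof \<delta>" \<rho> "\<lambda>i. \<phi> (f i)"] f \<phi> by blast
    then show False using \<psi> f by (meson less_asym)
  next
    case 2
    then obtain x where "x < \<delta>" "\<And>i. i < cof \<rho> \<Longrightarrow> \<psi> (g i) < x"
      using less_cof_bounded[of "cof \<rho>" \<delta> "\<lambda>i. \<psi> (g i)"] g \<psi>(1) by blast
    then show False using \<psi>(2) g \<phi> by (meson leD less_imp_le)
  qed
qed

text \<open>A limit point of \<open>E\<close> inside \<open>D\<close> would belong to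
  \<open>E\<close>. The point \<open>x0\<close> serves as bound when \<open>E\<close> has nothing
  below \<open>\<delta>\<close>.\<close>

lemma club_in_bounded_below:
  assumes "club_in E D" "\<delta> \<in> D" "\<delta> \<notin> E" "x0 < \<delta>"
  shows "\<exists>p<\<delta>. \<forall>e\<in>E. e < \<delta> \<longrightarrow> e \<le> p"
proof (cases "E \<inter> {..<\<delta>} = {}")
  case True
  then show ?thesis using assms(4) by blast
next
  case False
  then have "\<not> (\<forall>x<\<delta>. \<exists>e\<in>E. x < e \<and> e < \<delta>)"
    using assms(1-3) unfolding club_in_def by blast
  then show ?thesis by (meson not_le)
qed

text \<open>Nonreflection says nothing about countable cofinality, so a club is built by hand: a
  cofinal sequence of type omega has no limit points below \<open>\<gamma>\<close>, and its terms
  can be made successors.\<close>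

lemma countable_cof_club_nonlimit:
  fixes \<gamma> :: "'a::wellorder"
  assumes lim: "limit_ord \<gamma>" and cnt: "countable {..<cof \<gamma>}"
  shows "\<exists>c. club_in c {..<\<gamma>} \<and> (\<forall>x\<in>c. \<not> limit_ord x)"
proof -
  obtain f where f: "\<And>i. i < cof \<gamma> \<Longrightarrow> f i < \<gamma>" "\<And>x. x < \<gamma> \<Longrightarrow> \<exists>i<cof \<gamma>. x \<le> f i"
    using cof_cofinal[of \<gamma>] by blast
  have ne: "{..<cof \<gamma>} \<noteq> {}" using lim f(2) unfolding limit_ord_def by blast
  define a where "a n = f (from_nat_into {..<cof \<gamma>} n)" for n
  have a: "a n < \<gamma>" for n
    using from_nat_into[OF ne, of n] f(1) unfolding a_def by auto
  have a_cofinal: "\<exists>n. x \<le> a n" if x: "x < \<gamma>" for x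
  proof -
    obtain i where "i < cof \<gamma>" "x \<le> f i" using f(2)[OF x] by blast
    then show ?thesis using from_nat_into_surj[OF cnt, of i] unfolding a_def by auto
  qed
  define sc where "sc x = (LEAST y::'a. x < y)" for x
  have sc: "x < sc x \<and> sc x < \<gamma>" if "x < \<gamma>" for x
  proof -
    obtain y where y: "x < y" "y < \<gamma>" using lim \<open>x < \<gamma>\<close> unfolding limit_ord_def by blast
    then show ?thesis unfolding sc_def by (metis (mono_tags) LeastI Least_le le_less_trans)
  qed
  have sc_nonlimit: "\<not> limit_ord (sc x)" if "x < \<gamma>" for x
    using sc[OF that] not_less_Least[where P="\<lambda>y. x < y"] unfolding limit_ord_def sc_def by blast
  \<comment> \<open>The values dominate the cofinal sequence \<open>a\<close>, increase strictly,
    and are successors because each is a value of \<open>sc\<close>.\<close>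
  define g where "g = rec_nat (sc (a 0)) (\<lambda>n y. sc (max y (a (Suc n))))"
  have g0: "g 0 = sc (a 0)" and gS: "g (Suc n) = sc (max (g n) (a (Suc n)))" for n
    by (simp_all add: g_def)
  have g: "g n < \<gamma>" for n by (induction n) (auto simp: g0 gS a sc)
  have g_mono: "strict_mono g"
    unfolding strict_mono_Suc_iff
  proof
    fix n
    have "max (g n) (a (Suc n)) < \<gamma>" using g a by simp
    from sc[OF this] show "g n < g (Suc n)" unfolding gS by (metis max_less_iff_conj)
  qed
  have ag: "a n < g n" for n
  proof (cases n)
    case 0
    then show ?thesis using sc a g0 by simp
  next
    case (Suc m)
    have "max (g m) (a (Suc m)) < \<gamma>" using g a by simp
    from sc[OF this] show ?thesis unfolding Suc gS by (metis max_less_iff_conj)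
  qed
  have g_nonlimit: "\<not> limit_ord (g n)" for n
    by (cases n) (use g0 gS sc_nonlimit g a in auto)
  have "club_in (range g) {..<\<gamma>}"
    unfolding club_in_def
  proof (intro conjI ballI impI)
    show "range g \<subseteq> {..<\<gamma>}" using g by auto
  next
    fix x assume "x \<in> {..<\<gamma>}"
    then obtain n where "x \<le> a n" using a_cofinal by auto
    then show "\<exists>e\<in>range g. x \<le> e" using ag[of n] by (meson le_less_trans less_imp_le rangeI)
  next
    fix \<alpha> assume \<alpha>: "\<alpha> \<in> {..<\<gamma>}"
      and acc: "range g \<inter> {..<\<alpha>} \<noteq> {} \<and> (\<forall>x<\<alpha>. \<exists>e\<in>range g. x < e \<and> e < \<alpha>)"
    obtain n where n: "\<alpha> \<le> a n" using a_cofinal \<alpha> by auto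
    \<comment> \<open>Only finitely many terms lie below \<open>\<alpha>\<close>, and the largest of
      them leaves a gap under \<open>\<alpha>\<close>. So the premise of the closure clause
      fails.\<close>
    define N where "N = {m. g m < \<alpha>}"
    have "N \<subseteq> {..n}"
    proof
      fix m assume "m \<in> N"
      then have "g m < g n" using n ag[of n] unfolding N_def by auto
      then show "m \<in> {..n}" using g_mono by (simp add: strict_mono_less)
    qed
    then have fin: "finite N" using finite_subset by blast
    have N: "N \<noteq> {}" using acc unfolding N_def by auto
    then have "g (Max N) < \<alpha>" using Max_in[OF fin] unfolding N_def by auto
    then obtain m where m: "g (Max N) < g m" "g m < \<alpha>" using acc by blast
    then have "m \<le> Max N" using fin unfolding N_def by simp
    then show "\<alpha> \<in> range g" using m(1) g_mono by (simp add: strict_mono_less)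
  qed
  then show ?thesis using g_nonlimit by blast
qed

text \<open>Nonreflection handles uncountable cofinality, a club of nonlimit points the countable
  one; avoiding the limit elements of \<open>T\<close> is what both cases provide.\<close>

lemma nonreflecting_club:
  fixes \<gamma> :: "'a::wellorder"
  assumes "\<not> reflects T" "limit_ord \<gamma>"
  shows "\<exists>c. club_in c {..<\<gamma>} \<and> (\<forall>x\<in>c. \<not> (x \<in> T \<and> limit_ord x))"
proof (cases "countable {..<cof \<gamma>}")
  case True
  then show ?thesis using countable_cof_club_nonlimit[OF assms(2)] by blast
next
  case False
  then have "\<not> stationary_in (T \<inter> {..<\<gamma>}) {..<\<gamma>}" using assms(1) unfolding reflects_def by blast
  then obtain E where E: "club_in E {..<\<gamma>}" "T \<inter> {..<\<gamma>} \<inter> E = {}"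
    unfolding stationary_in_def by blast
  have "E \<subseteq> {..<\<gamma>}" using E(1) unfolding club_in_def by blast
  then show ?thesis using E by blast
qed

section \<open>Pairwise disjoint tails of the clubs\<close>

definition tails_disjoint ::
  "'a::wellorder set \<Rightarrow> ('a \<Rightarrow> 'a set) \<Rightarrow> 'a \<Rightarrow> ('a \<Rightarrow> 'a) \<Rightarrow> bool" where
  "tails_disjoint T c \<beta> F \<longleftrightarrow> (\<forall>\<delta>\<in>T. \<delta> < \<beta> \<longrightarrow> F \<delta> < \<delta>) \<and>
    (\<forall>\<delta>\<in>T. \<forall>\<delta>'\<in>T. \<forall>x\<in>c \<delta> \<inter> c \<delta>'. \<delta> < \<delta>' \<and> \<delta>' < \<beta> \<and> F \<delta> < x \<longrightarrow> x \<le> F \<delta>')"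

lemma tails_disjointD:
  assumes "tails_disjoint T c \<beta> F" "\<delta> \<in> T" "\<delta>' \<in> T" "x \<in> c \<delta>" "x \<in> c \<delta>'" "\<delta> < \<delta>'" "\<delta>' < \<beta>" "F \<delta> < x"
  shows "x \<le> F \<delta>'"
  using assms unfolding tails_disjoint_def by blast

lemma tails_disjoint_less: "tails_disjoint T c \<beta> F \<Longrightarrow> \<delta> \<in> T \<Longrightarrow> \<delta> < \<beta> \<Longrightarrow> F \<delta> < \<delta>"
  unfolding tails_disjoint_def by blast

text \<open>At a limit \<open>\<beta>\<close>, the club \<open>c \<beta>\<close> misses
  \<open>T\<close> and cuts it into gaps: the induction hypothesis separates ordinals in one gap,
  and \<open>c \<beta>\<close> separates different gaps. At the successor of
  \<open>\<gamma>\<close>, at most the index \<open>\<gamma>\<close> is new, and shortening the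
  earlier tails keeps them off its club.\<close>

lemma ex_tails_disjoint:
  fixes T :: "'a::wellorder set" and c :: "'a \<Rightarrow> 'a set"
  assumes T: "\<And>\<delta>. \<delta> \<in> T \<Longrightarrow> limit_ord \<delta>"
    and c: "\<And>\<gamma>. limit_ord \<gamma> \<Longrightarrow> club_in (c \<gamma>) {..<\<gamma>}"
    and cT: "\<And>\<gamma>. limit_ord \<gamma> \<Longrightarrow> c \<gamma> \<inter> T = {}"
  shows "\<exists>F. tails_disjoint T c \<beta> F"
proof (induction \<beta> rule: less_induct)
  case (less \<beta>)
  have bnd: "\<exists>p<\<delta>. \<forall>e\<in>c \<gamma>. e < \<delta> \<longrightarrow> e \<le> p" if "\<delta> \<in> T" "\<delta> < \<gamma>" "limit_ord \<gamma>" for \<delta> \<gamma>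
  proof -
    have "\<delta> \<notin> c \<gamma>" using cT that by blast
    moreover have "limit_ord \<delta>" using T \<open>\<delta> \<in> T\<close> .
    then obtain x where "x < \<delta>" unfolding limit_ord_def by blast
    ultimately show ?thesis
      using club_in_bounded_below[OF c[OF \<open>limit_ord \<gamma>\<close>], of \<delta>] \<open>\<delta> < \<gamma>\<close> by simp
  qed
  have c_sub: "x < \<gamma>" if "x \<in> c \<gamma>" "\<gamma> \<in> T" for x \<gamma>
    using c[OF T[OF that(2)]] that(1) unfolding club_in_def by blast
  show ?case
  proof (cases "limit_ord \<beta>")
    case True
    have "\<forall>n. \<exists>G. n < \<beta> \<longrightarrow> tails_disjoint T c n G" using less.IH by blast
    then obtain G where G: "\<And>n. n < \<beta> \<Longrightarrow> tails_disjoint T c n (G n)" by metis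
    have "\<forall>\<delta>. \<exists>p. \<delta> \<in> T \<longrightarrow> \<delta> < \<beta> \<longrightarrow> p < \<delta> \<and> (\<forall>e\<in>c \<beta>. e < \<delta> \<longrightarrow> e \<le> p)"
      using bnd True by blast
    then obtain p where p: "\<And>\<delta>. \<delta> \<in> T \<Longrightarrow> \<delta> < \<beta> \<Longrightarrow> p \<delta> < \<delta>"
      "\<And>\<delta> e. \<delta> \<in> T \<Longrightarrow> \<delta> < \<beta> \<Longrightarrow> e \<in> c \<beta> \<Longrightarrow> e < \<delta> \<Longrightarrow> e \<le> p \<delta>" by metis
    \<comment> \<open>The right end of the gap of \<open>c \<beta>\<close> that contains
      \<open>\<delta>\<close>.\<close>
    define n where "n \<delta> = (LEAST e. e \<in> c \<beta> \<and> \<delta> < e)" for \<delta>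
    have n: "n \<delta> \<in> c \<beta>" "\<delta> < n \<delta>" "n \<delta> < \<beta>" if \<delta>: "\<delta> \<in> T" "\<delta> < \<beta>" for \<delta>
    proof -
      obtain e where "e \<in> c \<beta>" "\<delta> \<le> e"
        using c[OF True] \<delta>(2) unfolding club_in_def by (meson lessThan_iff)
      moreover have "\<delta> \<notin> c \<beta>" using cT[OF True] \<delta> by blast
      ultimately have "e \<in> c \<beta> \<and> \<delta> < e" by (metis le_less)
      then have "n \<delta> \<in> c \<beta> \<and> \<delta> < n \<delta>" unfolding n_def by (rule LeastI)
      then show "n \<delta> \<in> c \<beta>" "\<delta> < n \<delta>" "n \<delta> < \<beta>"
        using c[OF True] unfolding club_in_def by auto
    qed
    \<comment> \<open>\<open>G (n \<delta>)\<close> is the induction hypothesis at the end of the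
      gap, and \<open>p \<delta>\<close> bounds the part of \<open>c \<beta>\<close> below
      \<open>\<delta>\<close>.\<close>
    let ?F = "\<lambda>\<delta>. max (G (n \<delta>) \<delta>) (p \<delta>)"
    show ?thesis
      unfolding tails_disjoint_def
    proof (intro exI[of _ ?F] conjI ballI impI)
      fix \<delta> assume "\<delta> \<in> T" "\<delta> < \<beta>"
      then show "?F \<delta> < \<delta>" using tails_disjoint_less[OF G] n p by simp
    next
      fix \<delta> \<delta>' x assume \<delta>: "\<delta> \<in> T" "\<delta>' \<in> T" and x: "x \<in> c \<delta> \<inter> c \<delta>'"
        and lt: "\<delta> < \<delta>' \<and> \<delta>' < \<beta> \<and> ?F \<delta> < x"
      have \<delta>\<beta>: "\<delta> < \<beta>" using lt by auto
      show "x \<le> ?F \<delta>'"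
      proof (cases "n \<delta> < \<delta>'")
        \<comment> \<open>Different gaps: \<open>x\<close> lies below \<open>n \<delta>\<close>, a
          point of \<open>c \<beta>\<close> under \<open>\<delta>'\<close>, and hence below
          \<open>p \<delta>'\<close>.\<close>
        case True
        then have "n \<delta> \<le> p \<delta>'" using p(2) \<delta> lt n(1) \<delta>\<beta> by blast
        moreover have "x < \<delta>" using c_sub x \<delta> by blast
        then have "x < n \<delta>" using n(2)[OF \<delta>(1) \<delta>\<beta>] by (rule less_trans)
        ultimately have "x \<le> p \<delta>'" by (simp add: less_le_trans less_imp_le)
        then show ?thesis by (simp add: le_max_iff_disj)
      next
        case False
        \<comment> \<open>This rules out \<open>n \<delta> = \<delta>'\<close>, so both ordinals
          share a gap and the single function \<open>G (n \<delta>)\<close> governs both.\<close>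
        have "\<delta>' \<notin> c \<beta>" using cT[OF \<open>limit_ord \<beta>\<close>] \<delta> by blast
        then have "\<delta>' < n \<delta>" using False n(1)[OF \<delta>(1) \<delta>\<beta>] by (metis neqE)
        have "n \<delta>' = n \<delta>"
        proof (rule antisym)
          show "n \<delta>' \<le> n \<delta>" unfolding n_def[of \<delta>']
            by (rule Least_le) (use n(1)[OF \<delta>(1) \<delta>\<beta>] \<open>\<delta>' < n \<delta>\<close> in blast)
          show "n \<delta> \<le> n \<delta>'" unfolding n_def[of \<delta>]
            by (rule Least_le) (use n[OF \<delta>(2)] lt in \<open>blast intro: less_trans\<close>)
        qed
        then have "x \<le> G (n \<delta>') \<delta>'"
          using tails_disjointD[OF G[OF n(3)[OF \<delta>(1) \<delta>\<beta>]], of \<delta> \<delta>' x] \<delta> x lt \<open>\<delta>' < n \<delta>\<close> by auto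
        then show ?thesis by (simp add: le_max_iff_disj)
      qed
    qed
  next
    case False
    show ?thesis
    proof (cases "\<exists>x. x < \<beta>")
      case True
      then obtain \<gamma> where \<gamma>: "\<gamma> < \<beta>" "\<And>y. y < \<beta> \<Longrightarrow> y \<le> \<gamma>"
        using False unfolding limit_ord_def by (meson not_le)
      obtain G where G: "tails_disjoint T c \<gamma> G" using less.IH[OF \<gamma>(1)] by blast
      show ?thesis
      proof (cases "\<gamma> \<in> T")
        case True
        have "\<forall>\<delta>. \<exists>p. \<delta> \<in> T \<longrightarrow> \<delta> < \<gamma> \<longrightarrow> p < \<delta> \<and> (\<forall>e\<in>c \<gamma>. e < \<delta> \<longrightarrow> e \<le> p)"
          using bnd T[OF True] by blast
        then obtain p where p: "\<And>\<delta>. \<delta> \<in> T \<Longrightarrow> \<delta> < \<gamma> \<Longrightarrow> p \<delta> < \<delta>"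
          "\<And>\<delta> e. \<delta> \<in> T \<Longrightarrow> \<delta> < \<gamma> \<Longrightarrow> e \<in> c \<gamma> \<Longrightarrow> e < \<delta> \<Longrightarrow> e \<le> p \<delta>" by metis
        obtain z where z: "z < \<gamma>" using T[OF True] unfolding limit_ord_def by blast
        \<comment> \<open>\<open>z\<close> is any ordinal below \<open>\<gamma>\<close>: the bound
          \<open>p\<close> alone keeps the earlier tails away from
          \<open>c \<gamma>\<close>.\<close>
        let ?F = "\<lambda>\<delta>. if \<delta> = \<gamma> then z else max (G \<delta>) (p \<delta>)"
        show ?thesis
          unfolding tails_disjoint_def
        proof (intro exI[of _ ?F] conjI ballI impI)
          fix \<delta> assume "\<delta> \<in> T" "\<delta> < \<beta>"
          then show "?F \<delta> < \<delta>" using tails_disjoint_less[OF G] p z \<gamma>(2)[of \<delta>] by auto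
        next
          fix \<delta> \<delta>' x assume \<delta>: "\<delta> \<in> T" "\<delta>' \<in> T" and x: "x \<in> c \<delta> \<inter> c \<delta>'"
            and lt: "\<delta> < \<delta>' \<and> \<delta>' < \<beta> \<and> ?F \<delta> < x"
          have "\<delta>' \<le> \<gamma>" using lt \<gamma>(2) by blast
          then have \<delta>\<gamma>: "\<delta> < \<gamma>" using lt by auto
          show "x \<le> ?F \<delta>'"
          proof (cases "\<delta>' = \<gamma>")
            case True
            have "x < \<delta>" using x c_sub \<delta> by blast
            then have "x \<le> p \<delta>" using p(2)[OF \<delta>(1) \<delta>\<gamma>] x True by blast
            moreover have "max (G \<delta>) (p \<delta>) < x" using lt \<delta>\<gamma> by (metis less_irrefl)
            ultimately show ?thesis by (simp add: leD)
          next
            case False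
            then have "\<delta>' < \<gamma>" using \<open>\<delta>' \<le> \<gamma>\<close> by simp
            moreover have "max (G \<delta>) (p \<delta>) < x" using lt \<delta>\<gamma> by (metis less_irrefl)
            ultimately have "x \<le> G \<delta>'" using tails_disjointD[OF G, of \<delta> \<delta>' x] \<delta> x lt \<delta>\<gamma> \<open>\<delta>' \<le> \<gamma>\<close> by auto
            then show ?thesis using False by (simp add: le_max_iff_disj)
          qed
        qed
      next
        case False
        then have "\<delta> < \<gamma>" if "\<delta> \<in> T" "\<delta> < \<beta>" for \<delta> using \<gamma>(2) that by (metis le_less)
        then have "tails_disjoint T c \<beta> G" using G unfolding tails_disjoint_def by blast
        then show ?thesis by blast
      qed
    next
      case False
      then show ?thesis unfolding tails_disjoint_def by auto
    qed
  qed
qed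

section \<open>Regularity, clubs and stationary sets in a successor cardinal\<close>

locale successor_type =
  fixes \<mu> :: "'a::wellorder"
  assumes succ: "type_is_successor_cardinal \<mu>" and inf: "infinite {..<\<mu>}"
begin

text \<open>The order of the type is itself a cardinal order, so its proper initial segments are
  smaller than the whole.\<close>

lemma UNIV_ordIso_cardSuc: "|UNIV :: 'a set| =o cardSuc |{..<\<mu>}|"
  and card_lessThan: "|{..<(\<delta>::'a)}| \<le>o |{..<\<mu>}|"
proof -
  let ?r = "{(x, y :: 'a). x \<le> y}"
  have iso: "?r =o cardSuc |{..<\<mu>}|" using succ unfolding type_is_successor_cardinal_def by blast
  then have card: "Card_order ?r"
    using Card_order_ordIso cardSuc_Card_order card_of_Card_order by blast
  have field: "Field ?r = UNIV" unfolding Field_def by auto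
  show "|UNIV :: 'a set| =o cardSuc |{..<\<mu>}|"
    using card_of_Field_ordIso[OF card] iso field ordIso_transitive by metis
  have "underS ?r \<delta> = {..<\<delta>}" unfolding underS_def by auto
  then have "|{..<\<delta>}| <o ?r" using card_of_underS[OF card, of \<delta>] field by simp
  then have "|{..<\<delta>}| <o cardSuc |{..<\<mu>}|" using iso ordLess_ordIso_trans by blast
  then show "|{..<\<delta>}| \<le>o |{..<\<mu>}|"
    using cardSuc_ordLeq_ordLess[OF card_of_Card_order card_of_Card_order] by blast
qed

text \<open>This is regularity of the successor cardinal: an unbounded \<open>A\<close> would make
  the whole type a union of at most \<open>\<mu>\<close> segments of size at most
  \<open>\<mu>\<close>.\<close>

lemma small_bounded:
  fixes A :: "'a set"
  assumes "|A| \<le>o |{..<\<mu>}|"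
  shows "\<exists>b. \<forall>a\<in>A. a < b"
proof (rule ccontr)
  assume "\<not> ?thesis"
  then have ub: "\<exists>a\<in>A. b \<le> a" for b by (meson not_le)
  have "{..a} = insert a {..<a}" for a :: 'a by auto
  then have "|{..a}| \<le>o |{..<\<mu>}|" for a :: 'a
    using card_lessThan[of a] inf
      card_of_Un_ordLeq_infinite_Field[OF _ _ _ card_of_Card_order, of "{..<\<mu>}" "{a}" "{..<a}"]
    by (simp add: card_of_singl_ordLeq infinite_imp_nonempty Field_card_of)
  then have "|\<Union>a\<in>A. {..a}| \<le>o |{..<\<mu>}|"
    using card_of_UNION_ordLeq_infinite[OF inf assms] by blast
  moreover have "(\<Union>a\<in>A. {..a}) = UNIV" using ub by auto
  ultimately have "|UNIV :: 'a set| \<le>o |{..<\<mu>}|" by simp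
  then have "cardSuc |{..<\<mu>}| \<le>o |{..<\<mu>}|"
    using UNIV_ordIso_cardSuc ordIso_ordLeq_trans ordIso_symmetric by blast
  then show False
    using cardSuc_greater[OF card_of_Card_order] not_ordLess_ordLeq by blast
qed

lemma ex_greater: "\<exists>y. x < (y::'a)"
proof -
  have "|{x}| \<le>o |{..<\<mu>}|" using inf by (simp add: card_of_singl_ordLeq infinite_imp_nonempty)
  then show ?thesis using small_bounded by blast
qed

lemma image_atMost_bounded:
  fixes g :: "'a \<Rightarrow> 'a"
  shows "\<exists>b. \<forall>z\<le>y. g z < b"
proof -
  obtain y' where y': "y < y'" using ex_greater by blast
  have "|g ` {..<y'}| \<le>o |{..<\<mu>}|" using card_of_image card_lessThan ordLeq_transitive by blast
  then obtain b where "\<forall>a\<in>g ` {..<y'}. a < b" using small_bounded by blast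
  then have "\<forall>z\<le>y. g z < b" using y' by auto
  then show ?thesis by blast
qed

text \<open>Unboundedness is the usual closing off: iterate a bound of \<open>g\<close> through
  omega steps and take the least strict upper bound, which exists by
  \<open>small_bounded\<close>.\<close>

lemma club_closure_points:
  fixes g :: "'a \<Rightarrow> 'a"
  shows "club_in {\<delta>. (\<exists>x. x < \<delta>) \<and> (\<forall>x<\<delta>. g x < \<delta>)} UNIV"
  unfolding club_in_def
proof (intro conjI ballI impI)
  fix x :: 'a
  \<comment> \<open>\<open>h y\<close> bounds \<open>g\<close> on the whole segment up to
    \<open>y\<close>, so every \<open>z\<close> at or below some \<open>s n\<close> has
    \<open>g z < s (Suc n)\<close>.\<close>
  have "\<forall>y. \<exists>b. \<forall>z\<le>y. g z < b" using image_atMost_bounded by blast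
  then obtain h where h: "\<And>y z. z \<le> y \<Longrightarrow> g z < h y" by metis
  define s where "s = rec_nat x (\<lambda>_. h)"
  have s0: "s 0 = x" and sS: "s (Suc n) = h (s n)" for n by (simp_all add: s_def)
  have "|range s| \<le>o |{..<\<mu>}|"
    using card_of_image inf infinite_iff_card_of_nat ordLeq_transitive by blast
  then obtain d0 where "\<forall>n. s n < d0" using small_bounded by blast
  define d where "d = (LEAST d. \<forall>n. s n < d)"
  have d: "s n < d" for n using LeastI[of "\<lambda>d. \<forall>n. s n < d", OF \<open>\<forall>n. s n < d0\<close>] d_def by blast
  have "g z < d" if "z < d" for z
  proof -
    have "\<not> (\<forall>n. s n < z)" using \<open>z < d\<close> unfolding d_def by (rule not_less_Least)
    then obtain n where "z \<le> s n" by (meson not_le)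
    then show ?thesis using h[of z "s n"] d[of "Suc n"] sS by (metis less_trans)
  qed
  moreover have "x < d" using d[of 0] s0 by simp
  ultimately show "\<exists>e\<in>{\<delta>. (\<exists>x. x < \<delta>) \<and> (\<forall>x<\<delta>. g x < \<delta>)}. x \<le> e"
    by (intro bexI[of _ d]) auto
next
  fix \<alpha> :: 'a
  let ?E = "{\<delta>. (\<exists>x. x < \<delta>) \<and> (\<forall>x<\<delta>. g x < \<delta>)}"
  assume E: "?E \<inter> {..<\<alpha>} \<noteq> {} \<and> (\<forall>x<\<alpha>. \<exists>e\<in>?E. x < e \<and> e < \<alpha>)"
  have "g x < \<alpha>" if "x < \<alpha>" for x
  proof -
    obtain e where "e \<in> ?E" "x < e" "e < \<alpha>" using E \<open>x < \<alpha>\<close> by blast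
    then have "g x < e" "e < \<alpha>" by simp_all
    then show ?thesis by (rule less_trans)
  qed
  then show "\<alpha> \<in> ?E" using E by blast
qed auto

text \<open>By regularity some \<open>g x\<close> bounds points chosen above \<open>x\<close> in all
  the \<open>E k\<close>. A nonzero closure point of \<open>g\<close> is then a limit point of every
  \<open>E k\<close>.\<close>

lemma club_INTER:
  assumes K: "|K| \<le>o |{..<\<mu>}|" and E: "\<And>k. k \<in> K \<Longrightarrow> club_in (E k) (UNIV :: 'a set)"
  shows "club_in (\<Inter>k\<in>K. E k) UNIV"
proof -
  have ex: "\<exists>b. \<forall>k\<in>K. \<exists>e\<in>E k. x < e \<and> e < b" for x
  proof -
    obtain y where y: "x < y" using ex_greater by blast
    have "\<forall>k\<in>K. \<exists>e. e \<in> E k \<and> y \<le> e" using E unfolding club_in_def by blast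
    then obtain e where e: "\<And>k. k \<in> K \<Longrightarrow> e k \<in> E k \<and> y \<le> e k" by metis
    have "|e ` K| \<le>o |{..<\<mu>}|" using card_of_image K ordLeq_transitive by blast
    then obtain b where "\<forall>a\<in>e ` K. a < b" using small_bounded by blast
    then have "\<forall>k\<in>K. e k \<in> E k \<and> x < e k \<and> e k < b" using e y by fastforce
    then show ?thesis by blast
  qed
  then obtain g where g: "\<And>x k. k \<in> K \<Longrightarrow> \<exists>e\<in>E k. x < e \<and> e < g x" by metis
  have in_E: "\<delta> \<in> E k" if \<delta>: "z < \<delta>" "\<forall>x<\<delta>. g x < \<delta>" and k: "k \<in> K" for \<delta> z k
  proof -
    have lim: "\<forall>x<\<delta>. \<exists>e\<in>E k. x < e \<and> e < \<delta>" using g[OF k] \<delta>(2) by (meson less_trans)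
    then have "E k \<inter> {..<\<delta>} \<noteq> {}" using \<delta>(1) by blast
    with lim show ?thesis using E[OF k] unfolding club_in_def by blast
  qed
  show ?thesis unfolding club_in_def
  proof (intro conjI ballI impI)
    fix x :: 'a
    obtain \<delta> where "x \<le> \<delta>" "\<exists>z. z < \<delta>" "\<forall>x<\<delta>. g x < \<delta>"
      using club_closure_points[of g] unfolding club_in_def by blast
    then show "\<exists>e\<in>\<Inter>k\<in>K. E k. x \<le> e" using in_E by blast
  next
    fix \<alpha> :: 'a
    assume \<alpha>: "(\<Inter>k\<in>K. E k) \<inter> {..<\<alpha>} \<noteq> {} \<and> (\<forall>x<\<alpha>. \<exists>e\<in>\<Inter>k\<in>K. E k. x < e \<and> e < \<alpha>)"
    show "\<alpha> \<in> (\<Inter>k\<in>K. E k)"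
    proof
      fix k assume k: "k \<in> K"
      have "E k \<inter> {..<\<alpha>} \<noteq> {} \<and> (\<forall>x<\<alpha>. \<exists>e\<in>E k. x < e \<and> e < \<alpha>)" using \<alpha> k by blast
      then show "\<alpha> \<in> E k" using E[OF k] unfolding club_in_def by blast
    qed
  qed auto
qed

lemma club_Int:
  assumes "club_in A (UNIV :: 'a set)" "club_in B UNIV"
  shows "club_in (A \<inter> B) UNIV"
proof -
  have "|UNIV :: bool set| \<le>o |{..<\<mu>}|"
    by (rule ordLess_imp_ordLeq[OF finite_ordLess_infinite[OF card_of_Well_order card_of_Well_order]])
      (simp_all add: Field_card_of inf)
  from club_INTER[OF this, of "\<lambda>k. if k then A else B"] show ?thesis
    using assms by (simp add: UNIV_bool Int_commute)
qed

lemma club_greaterThan: "club_in {z<..} (UNIV :: 'a set)"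
  unfolding club_in_def
proof (intro conjI ballI impI)
  fix x :: 'a
  obtain y where "max x z < y" using ex_greater by blast
  then show "\<exists>e\<in>{z<..}. x \<le> e" by (intro bexI[of _ y]) auto
next
  fix \<alpha> :: 'a
  assume "{z<..} \<inter> {..<\<alpha>} \<noteq> {} \<and> (\<forall>x<\<alpha>. \<exists>e\<in>{z<..}. x < e \<and> e < \<alpha>)"
  then obtain e where "z < e" "e < \<alpha>" by blast
  then have "z < \<alpha>" by (rule less_trans)
  then show "\<alpha> \<in> {z<..}" by simp
qed simp

text \<open>Limit ordinals are the nonzero closure points of the successor function.\<close>

lemma club_limit: "club_in {\<delta>. limit_ord \<delta>} (UNIV :: 'a set)"
proof -
  define sc where "sc x = (LEAST y. x < y)" for x :: 'a
  have less_sc: "x < sc x" for x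
  proof -
    obtain y where "x < y" using ex_greater by blast
    then show ?thesis unfolding sc_def by (rule LeastI)
  qed
  have sc_le: "sc x \<le> y" if "x < y" for x y using that unfolding sc_def by (rule Least_le)
  have "(\<exists>y<\<delta>. x < y) \<longleftrightarrow> sc x < \<delta>" for x \<delta>
    using less_sc[of x] sc_le[of x] le_less_trans by blast
  then have "{\<delta>. limit_ord \<delta>} = {\<delta>. (\<exists>x. x < \<delta>) \<and> (\<forall>x<\<delta>. sc x < \<delta>)}"
    unfolding limit_ord_def by simp
  then show ?thesis using club_closure_points[of sc] by simp
qed

text \<open>The part of Fodor's lemma that needs no diagonal intersection.\<close>

lemma pressing_down_unbounded:
  fixes T :: "'a set"
  assumes T: "stationary_in T UNIV" and f: "\<And>\<delta>. \<delta> \<in> T \<Longrightarrow> f \<delta> < \<delta>"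
  shows "\<exists>\<alpha>. \<forall>b. \<exists>\<delta>\<in>T. f \<delta> = \<alpha> \<and> b \<le> \<delta>"
proof (rule ccontr)
  assume "\<not> ?thesis"
  then have "\<forall>\<alpha>. \<exists>b. \<forall>\<delta>\<in>T. f \<delta> = \<alpha> \<longrightarrow> \<delta> < b" by (meson not_le)
  \<comment> \<open>\<open>g\<close> bounds each fibre of \<open>f\<close>. A closure point of
    \<open>g\<close> in \<open>T\<close> would exceed the bound of its own fibre.\<close>
  then obtain g where g: "\<forall>\<alpha>. \<forall>\<delta>\<in>T. f \<delta> = \<alpha> \<longrightarrow> \<delta> < g \<alpha>" by metis
  obtain \<delta> where "\<delta> \<in> T" "\<forall>x<\<delta>. g x < \<delta>"
    using T club_closure_points[of g] unfolding stationary_in_def by blast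
  then have "g (f \<delta>) < \<delta>" "\<delta> < g (f \<delta>)" using f g by simp_all
  then show False by simp
qed

text \<open>By regularity an unbounded set has more than \<open>\<mu>\<close> elements. It is cut
  down to exactly \<open>\<mu>\<close> because weak saturation concerns partitions of that
  size.\<close>

lemma unbounded_card:
  fixes U :: "'a set"
  assumes "\<forall>b. \<exists>\<delta>\<in>U. b \<le> \<delta>"
  shows "\<exists>V\<subseteq>U. |V| =o |{..<\<mu>}|"
proof -
  have "\<not> |U| \<le>o |{..<\<mu>}|"
  proof
    assume "|U| \<le>o |{..<\<mu>}|"
    then obtain b where "\<forall>a\<in>U. a < b" using small_bounded by blast
    moreover obtain \<delta> where "\<delta> \<in> U" "b \<le> \<delta>" using assms by blast
    ultimately show False by force
  qed
  then have "|{..<\<mu>}| \<le>o |U|" using ordLeq_total[OF card_of_Well_order card_of_Well_order] by blast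
  then obtain V where "V \<subseteq> U" "|{..<\<mu>}| =o |V|" using internalize_card_of_ordLeq2[of "{..<\<mu>}" U] by blast
  then show ?thesis using ordIso_symmetric by blast
qed

lemma stationary_Int_club:
  fixes T :: "'a set"
  assumes "stationary_in T UNIV" "club_in E UNIV"
  shows "stationary_in (T \<inter> E) UNIV"
  unfolding stationary_in_def
proof (intro conjI allI impI)
  fix E' :: "'a set" assume "club_in E' UNIV"
  then have "club_in (E \<inter> E') UNIV" using assms(2) by (rule club_Int[rotated])
  then show "T \<inter> E \<inter> E' \<noteq> {}" using assms(1) unfolding stationary_in_def by (simp add: Int_assoc)
qed simp

end

section \<open>The ideals \<open>I \<epsilon>\<close> and \<open>id_p\<close>\<close>

text \<open>For a directed family, the sets covered by a single generator already form an
  ideal.\<close>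

lemma generated_ideal_directed:
  assumes "G \<subseteq> Pow X" "G \<noteq> {}"
    and dir: "\<And>A B. A \<in> G \<Longrightarrow> B \<in> G \<Longrightarrow> \<exists>D\<in>G. A \<union> B \<subseteq> D"
  shows "A \<in> generated_ideal X G \<longleftrightarrow> (\<exists>D\<in>G. A \<subseteq> D)"
proof
  let ?J = "{A. \<exists>D\<in>G. A \<subseteq> D}"
  have "ideal_on X ?J"
    unfolding ideal_on_def
  proof (intro conjI allI ballI impI)
    fix A B assume "A \<in> ?J" "B \<in> ?J"
    then obtain D1 D2 where "D1 \<in> G" "A \<subseteq> D1" "D2 \<in> G" "B \<subseteq> D2" by blast
    then show "A \<union> B \<in> ?J" using dir[of D1 D2] by blast
  next
    fix A B assume "B \<in> ?J \<and> A \<subseteq> B"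
    then show "A \<in> ?J" by blast
  qed (use assms(1,2) in auto)
  moreover have "G \<subseteq> ?J" by blast
  moreover assume "A \<in> generated_ideal X G"
  ultimately show "\<exists>D\<in>G. A \<subseteq> D" unfolding generated_ideal_def by blast
next
  assume "\<exists>D\<in>G. A \<subseteq> D"
  then obtain D where D: "D \<in> G" "A \<subseteq> D" by blast
  have "A \<in> J" if "ideal_on X J" "G \<subseteq> J" for J
  proof -
    have "D \<in> J" using D(1) \<open>G \<subseteq> J\<close> by blast
    then show ?thesis using D(2) \<open>ideal_on X J\<close> unfolding ideal_on_def by metis
  qed
  then show "A \<in> generated_ideal X G" unfolding generated_ideal_def by blast
qed

locale fair = successor_type \<mu> for \<mu> :: "'a::wellorder" +
  fixes S :: "'a set" and C :: "'a \<Rightarrow> 'a set" and I :: "'a \<Rightarrow> 'a set set"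
  assumes S_cof: "S \<subseteq> {\<delta>. cof \<delta> = cof \<mu>}" and pair: "fair_pair \<mu> S C I"
begin

definition small_part :: "'a \<Rightarrow> 'a \<Rightarrow> 'a \<Rightarrow> 'a set" where
  "small_part \<epsilon> \<alpha> \<beta> = {\<gamma> \<in> C \<epsilon>. \<gamma> \<in> acc (C \<epsilon>) \<or> cof \<gamma> < \<alpha> \<or> \<gamma> < \<beta>}"

lemma small_part_mono:
  assumes "\<alpha> \<le> \<alpha>'" "\<beta> \<le> \<beta>'"
  shows "small_part \<epsilon> \<alpha> \<beta> \<subseteq> small_part \<epsilon> \<alpha>' \<beta>'"
proof -
  have "x < \<alpha> \<Longrightarrow> x < \<alpha>'" "x < \<beta> \<Longrightarrow> x < \<beta>'" for x using assms by order+
  then show ?thesis unfolding small_part_def by blast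
qed

text \<open>At zero the generating family would be empty. The cofinality excludes this: it equals
  that of the infinite \<open>\<mu>\<close> and so is nonzero.\<close>

lemma S_pos:
  assumes "\<epsilon> \<in> S" shows "\<exists>x. x < \<epsilon>"
proof -
  obtain f where f: "\<And>i. i < cof \<epsilon> \<Longrightarrow> f i < \<epsilon>" "\<And>x. x < \<epsilon> \<Longrightarrow> \<exists>i<cof \<epsilon>. x \<le> f i"
    using cof_cofinal[of \<epsilon>] by blast
  obtain g where g: "\<And>i. i < cof \<mu> \<Longrightarrow> g i < \<mu>" "\<And>x. x < \<mu> \<Longrightarrow> \<exists>i<cof \<mu>. x \<le> g i"
    using cof_cofinal[of \<mu>] by blast
  have "cof \<epsilon> = cof \<mu>" using S_cof assms by blast
  moreover obtain z where "z < \<mu>" using inf infinite_imp_nonempty by blast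
  ultimately show ?thesis using f g by metis
qed

text \<open>Taking maxima of both parameters shows that the generators are directed.\<close>

lemma in_I_iff:
  assumes "\<epsilon> \<in> S"
  shows "A \<in> I \<epsilon> \<longleftrightarrow> (\<exists>\<alpha><\<mu>. \<exists>\<beta><\<epsilon>. A \<subseteq> small_part \<epsilon> \<alpha> \<beta>)"
proof -
  let ?G = "{small_part \<epsilon> \<alpha> \<beta> |\<alpha> \<beta>. \<alpha> < \<mu> \<and> \<beta> < \<epsilon>}"
  have "I \<epsilon> = generated_ideal (C \<epsilon>) ?G"
    using pair assms unfolding fair_pair_def small_part_def by blast
  moreover have "?G \<subseteq> Pow (C \<epsilon>)" unfolding small_part_def by blast
  moreover have "?G \<noteq> {}"
  proof -
    obtain z where "z < \<mu>" using inf infinite_imp_nonempty by blast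
    then show ?thesis using S_pos[OF assms] by blast
  qed
  moreover have "\<exists>D\<in>?G. A \<union> B \<subseteq> D" if AB: "A \<in> ?G" "B \<in> ?G" for A B
  proof -
    obtain \<alpha> \<beta> \<alpha>' \<beta>' where A: "A = small_part \<epsilon> \<alpha> \<beta>" "B = small_part \<epsilon> \<alpha>' \<beta>'"
      and lt: "\<alpha> < \<mu>" "\<beta> < \<epsilon>" "\<alpha>' < \<mu>" "\<beta>' < \<epsilon>" using AB by blast
    have "A \<union> B \<subseteq> small_part \<epsilon> (max \<alpha> \<alpha>') (max \<beta> \<beta>')"
      unfolding A by (intro Un_least small_part_mono) auto
    moreover have "max \<alpha> \<alpha>' < \<mu>" "max \<beta> \<beta>' < \<epsilon>" using lt by auto
    ultimately show ?thesis by blast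
  qed
  ultimately show ?thesis using generated_ideal_directed[of ?G "C \<epsilon>" A] by auto
qed

lemma id_p_subset:
  assumes "B \<in> id_p S C I" "A \<subseteq> B"
  shows "A \<in> id_p S C I"
proof -
  obtain E where E: "club_in E UNIV" "\<forall>\<delta>\<in>S \<inter> E. E \<inter> B \<inter> C \<delta> \<in> I \<delta>"
    using assms(1) unfolding id_p_def by blast
  have "E \<inter> A \<inter> C \<delta> \<in> I \<delta>" if "\<delta> \<in> S \<inter> E" for \<delta>
  proof -
    have "E \<inter> A \<inter> C \<delta> \<subseteq> E \<inter> B \<inter> C \<delta>" using assms(2) by blast
    then show ?thesis using E(2) that in_I_iff[of \<delta>] by (meson IntE subset_trans)
  qed
  then show ?thesis using E(1) unfolding id_p_def by blast
qed

text \<open>Fairness for the club \<open>E \<inter> {z<..}\<close> yields an index in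
  \<open>E\<close> with positive trace, against the choice of \<open>E\<close>.\<close>

lemma greaterThan_notin_id_p: "{z<..} \<notin> id_p S C I"
proof
  assume "{z<..} \<in> id_p S C I"
  then obtain E where E: "club_in E UNIV" "\<forall>\<delta>\<in>S \<inter> E. E \<inter> {z<..} \<inter> C \<delta> \<in> I \<delta>"
    unfolding id_p_def by blast
  have club: "club_in (E \<inter> {z<..}) UNIV" using E(1) club_greaterThan by (rule club_Int)
  then have "stationary_in {\<delta>\<in>S. E \<inter> {z<..} \<inter> C \<delta> \<notin> I \<delta>} UNIV"
    using pair unfolding fair_pair_def by blast
  then show False using club E(2) unfolding stationary_in_def by blast
qed

text \<open>Each \<open>B \<eta>\<close> has its own pair of bounds at \<open>\<epsilon>\<close>.
  Since \<open>cof \<delta>\<close> differs from the cofinalities of \<open>\<mu>\<close> and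
  \<open>\<epsilon>\<close>, one pair serves for cofinally many \<open>\<eta>\<close>, and by
  monotonicity these sets cover the union.\<close>

lemma id_p_increasing_union:
  assumes ne: "cof \<delta> \<noteq> cof \<mu>"
    and mono: "\<And>\<eta> \<eta>'. \<eta> \<le> \<eta>' \<Longrightarrow> \<eta>' < \<delta> \<Longrightarrow> B \<eta> \<subseteq> B \<eta>'"
    and B: "\<And>\<eta>. \<eta> < \<delta> \<Longrightarrow> B \<eta> \<in> id_p S C I"
  shows "(\<Union>\<eta><\<delta>. B \<eta>) \<in> id_p S C I"
proof -
  have "\<forall>\<eta>. \<exists>E. \<eta> < \<delta> \<longrightarrow> club_in E UNIV \<and> (\<forall>\<epsilon>\<in>S \<inter> E. E \<inter> B \<eta> \<inter> C \<epsilon> \<in> I \<epsilon>)"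
    using B unfolding id_p_def by blast
  then obtain E where E: "\<And>\<eta>. \<eta> < \<delta> \<Longrightarrow> club_in (E \<eta>) UNIV"
    "\<And>\<eta> \<epsilon>. \<eta> < \<delta> \<Longrightarrow> \<epsilon> \<in> S \<Longrightarrow> \<epsilon> \<in> E \<eta> \<Longrightarrow> E \<eta> \<inter> B \<eta> \<inter> C \<epsilon> \<in> I \<epsilon>"
    by (metis IntI)
  let ?E = "\<Inter>\<eta>\<in>{..<\<delta>}. E \<eta>"
  have "club_in ?E UNIV" using club_INTER[OF card_lessThan] E(1) by blast
  moreover have "?E \<inter> (\<Union>\<eta><\<delta>. B \<eta>) \<inter> C \<epsilon> \<in> I \<epsilon>" if \<epsilon>: "\<epsilon> \<in> S \<inter> ?E" for \<epsilon>
  proof -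
    have \<epsilon>S: "\<epsilon> \<in> S" using \<epsilon> by blast
    then have ne': "cof \<delta> \<noteq> cof \<epsilon>" using ne S_cof by auto
    have "\<forall>\<eta>. \<exists>\<alpha> \<beta>. \<eta> < \<delta> \<longrightarrow> \<alpha> < \<mu> \<and> \<beta> < \<epsilon> \<and> E \<eta> \<inter> B \<eta> \<inter> C \<epsilon> \<subseteq> small_part \<epsilon> \<alpha> \<beta>"
      using E(2) \<epsilon> in_I_iff[OF \<epsilon>S] by (metis IntE INT_E lessThan_iff)
    then obtain al be where ab: "\<And>\<eta>. \<eta> < \<delta> \<Longrightarrow> al \<eta> < \<mu>" "\<And>\<eta>. \<eta> < \<delta> \<Longrightarrow> be \<eta> < \<epsilon>"
      "\<And>\<eta>. \<eta> < \<delta> \<Longrightarrow> E \<eta> \<inter> B \<eta> \<inter> C \<epsilon> \<subseteq> small_part \<epsilon> (al \<eta>) (be \<eta>)" by metis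
    obtain a where a: "a < \<mu>" "\<And>x. x < \<delta> \<Longrightarrow> \<exists>\<eta><\<delta>. x \<le> \<eta> \<and> al \<eta> \<le> a"
      using cof_neq_bounded_cofinally[of \<delta> \<mu> al] ne ab(1) by blast
    \<comment> \<open>\<open>u\<close> moves every index up to one where \<open>al\<close> is at
      most \<open>a\<close>. The second bound is sought for \<open>be (u \<eta>)\<close>, so that
      both bounds hold at the same index.\<close>
    then obtain u where u: "\<And>x. x < \<delta> \<Longrightarrow> u x < \<delta> \<and> x \<le> u x \<and> al (u x) \<le> a" by metis
    obtain b where b: "b < \<epsilon>" "\<And>x. x < \<delta> \<Longrightarrow> \<exists>\<eta><\<delta>. x \<le> \<eta> \<and> be (u \<eta>) \<le> b"
      using cof_neq_bounded_cofinally[of \<delta> \<epsilon> "\<lambda>\<eta>. be (u \<eta>)"] ne' ab(2) u by blast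
    have "?E \<inter> (\<Union>\<eta><\<delta>. B \<eta>) \<inter> C \<epsilon> \<subseteq> small_part \<epsilon> a b"
    proof
      fix x assume x: "x \<in> ?E \<inter> (\<Union>\<eta><\<delta>. B \<eta>) \<inter> C \<epsilon>"
      then obtain \<eta> where \<eta>: "\<eta> < \<delta>" "x \<in> B \<eta>" by blast
      obtain \<zeta> where \<zeta>: "\<zeta> < \<delta>" "\<eta> \<le> \<zeta>" "be (u \<zeta>) \<le> b" using b(2)[OF \<eta>(1)] by blast
      have uz: "u \<zeta> < \<delta>" "\<eta> \<le> u \<zeta>" "al (u \<zeta>) \<le> a"
        using u[OF \<zeta>(1)] \<zeta>(2) by auto
      have "x \<in> B (u \<zeta>)" using mono[OF uz(2,1)] \<eta>(2) by blast
      then have "x \<in> small_part \<epsilon> (al (u \<zeta>)) (be (u \<zeta>))" using ab(3)[OF uz(1)] x uz(1) by blast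
      then show "x \<in> small_part \<epsilon> a b" using small_part_mono[OF uz(3) \<zeta>(3)] by blast
    qed
    then show ?thesis using in_I_iff[OF \<epsilon>S] a(1) b(1) by blast
  qed
  ultimately show ?thesis unfolding id_p_def by blast
qed

text \<open>Giving the uncovered ordinals to one of the sets yields a partition. Positive sets are
  nonempty, so disjoint blocks are distinct and there are exactly \<open>\<mu>\<close> of
  them.\<close>

lemma disjoint_positive_not_saturated:
  assumes V: "|V| =o |{..<\<mu>}|"
    and pos: "\<And>\<delta>. \<delta> \<in> V \<Longrightarrow> B \<delta> \<notin> id_p S C I"
    and disj: "\<And>\<delta> \<delta>' x. \<delta> \<in> V \<Longrightarrow> \<delta>' \<in> V \<Longrightarrow> x \<in> B \<delta> \<Longrightarrow> x \<in> B \<delta>' \<Longrightarrow> \<delta> = \<delta>'"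
  shows "\<not> weakly_saturated \<mu> UNIV (id_p S C I)"
proof -
  have "{..<\<mu>} \<noteq> {}" using inf infinite_imp_nonempty by blast
  then obtain \<delta>0 where \<delta>0: "\<delta>0 \<in> V"
    using V by (metis card_of_empty3 equals0I ordIso_iff_ordLeq)
  have "{} \<in> id_p S C I"
  proof -
    have "{} \<in> I \<epsilon>" if "\<epsilon> \<in> S" for \<epsilon>
    proof -
      obtain z where "z < \<mu>" using inf infinite_imp_nonempty by blast
      then show ?thesis using S_pos[OF that] in_I_iff[OF that] by blast
    qed
    then show ?thesis using club_limit unfolding id_p_def by auto
  qed
  \<comment> \<open>The block at \<open>\<delta>0\<close> absorbs the remainder; it stays positive
    because \<open>id_p\<close> is closed under subsets.\<close>
  define Q where "Q \<delta> = (if \<delta> = \<delta>0 then B \<delta>0 \<union> (UNIV - (\<Union>\<delta>\<in>V. B \<delta>)) else B \<delta>)" for \<delta>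
  have Q_sup: "B \<delta> \<subseteq> Q \<delta>" for \<delta> unfolding Q_def by auto
  have Q_pos: "Q \<delta> \<notin> id_p S C I" if "\<delta> \<in> V" for \<delta>
    using pos[OF that] id_p_subset Q_sup by blast
  have Q_disj: "\<delta> = \<delta>'" if "\<delta> \<in> V" "\<delta>' \<in> V" "x \<in> Q \<delta>" "x \<in> Q \<delta>'" for \<delta> \<delta>' x
    using that disj[of \<delta> \<delta>' x] \<delta>0 unfolding Q_def by (auto split: if_splits)
  have Q_ne: "Q \<delta> \<noteq> {}" if "\<delta> \<in> V" for \<delta> using Q_pos[OF that] \<open>{} \<in> id_p S C I\<close> by auto
  have "partition_on UNIV (Q ` V)"
  proof (rule partition_onI)
    show "\<Union> (Q ` V) = UNIV" using \<delta>0 Q_sup unfolding Q_def by auto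
    show "\<And>p q. p \<in> Q ` V \<Longrightarrow> q \<in> Q ` V \<Longrightarrow> p \<noteq> q \<Longrightarrow> disjnt p q"
      using Q_disj unfolding disjnt_def by blast
    show "{} \<notin> Q ` V" using Q_ne by blast
  qed
  moreover have "inj_on Q V"
  proof (rule inj_onI)
    fix x y assume "x \<in> V" "y \<in> V" "Q x = Q y"
    then show "x = y" using Q_ne[of x] Q_disj[of x y] by blast
  qed
  then have "|Q ` V| =o |{..<\<mu>}|"
    using V card_of_ordIsoI[OF inj_on_imp_bij_betw] ordIso_symmetric ordIso_transitive by blast
  ultimately show ?thesis using Q_pos unfolding weakly_saturated_def by blast
qed

end

section \<open>The contradiction from a nonreflecting stationary set\<close>

theorem theorem6p5:
  fixes \<mu> :: "'a::wellorder"
    and S :: "'a set"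
    and C :: "'a \<Rightarrow> 'a set"
    and I :: "'a \<Rightarrow> 'a set set"
  assumes "type_is_successor_cardinal \<mu>"
    and "strong_limit_cardinal \<mu>"
    and "singular_cardinal \<mu>"
    and "stationary_in S UNIV"
    and "S \<subseteq> {\<delta>. cof \<delta> = cof \<mu>}"
    and "fair_pair \<mu> S C I"
    and "weakly_saturated \<mu> UNIV (id_p S C I)"
  shows "\<forall>T. stationary_in T UNIV \<and> T \<subseteq> {\<delta>. cof \<delta> \<noteq> cof \<mu>} \<longrightarrow> reflects T"
proof (intro allI impI, rule ccontr)
  interpret fair \<mu> S C I
    using assms(1,3,5,6) by unfold_locales (auto simp: singular_cardinal_def)
  fix T0 :: "'a set"
  assume T0: "stationary_in T0 UNIV \<and> T0 \<subseteq> {\<delta>. cof \<delta> \<noteq> cof \<mu>}" and nr: "\<not> reflects T0"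
  \<comment> \<open>The clubs from \<open>nonreflecting_club\<close> avoid only the limit ordinals
    in \<open>T0\<close>, so the others are discarded. Stationarity survives because the limits form
    a club.\<close>
  define T where "T = T0 \<inter> {\<delta>. limit_ord \<delta>}"
  have T: "stationary_in T UNIV" "\<And>\<delta>. \<delta> \<in> T \<Longrightarrow> limit_ord \<delta>" "\<And>\<delta>. \<delta> \<in> T \<Longrightarrow> cof \<delta> \<noteq> cof \<mu>"
    using T0 stationary_Int_club[OF _ club_limit] unfolding T_def by auto
  have "\<forall>\<gamma>. \<exists>c. limit_ord \<gamma> \<longrightarrow> club_in c {..<\<gamma>} \<and> c \<inter> T = {}"
    using nonreflecting_club[OF nr] unfolding T_def by (metis disjoint_iff IntE mem_Collect_eq)
  then obtain c where c: "\<And>\<gamma>. limit_ord \<gamma> \<Longrightarrow> club_in (c \<gamma>) {..<\<gamma>}"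
    "\<And>\<gamma>. limit_ord \<gamma> \<Longrightarrow> c \<gamma> \<inter> T = {}" by metis
  have "\<forall>\<beta>. \<exists>F. tails_disjoint T c \<beta> F" using ex_tails_disjoint[of T c] T(2) c by blast
  then obtain F where F: "\<And>\<beta>. tails_disjoint T c \<beta> (F \<beta>)" by metis
  \<comment> \<open>For \<open>\<delta> \<in> T\<close> these sets grow with \<open>\<eta>\<close>
    and exhaust \<open>{\<delta><..}\<close> as \<open>\<eta>\<close> runs below
    \<open>\<delta>\<close>, since \<open>F \<beta> \<delta> < \<delta>\<close>.\<close>
  define B where "B \<delta> \<eta> = {\<beta>. \<delta> < \<beta> \<and> F \<beta> \<delta> \<le> \<eta>}" for \<delta> \<eta>
  have "\<exists>\<eta>\<^sub>0<\<delta>. B \<delta> \<eta>\<^sub>0 \<notin> id_p S C I" if \<delta>: "\<delta> \<in> T" for \<delta>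
  proof (rule ccontr)
    assume "\<not> ?thesis"
    then have "(\<Union>\<eta><\<delta>. B \<delta> \<eta>) \<in> id_p S C I"
      using T(3)[OF \<delta>] by (intro id_p_increasing_union) (auto simp: B_def)
    moreover have "{\<delta><..} \<subseteq> (\<Union>\<eta><\<delta>. B \<delta> \<eta>)" using tails_disjoint_less[OF F \<delta>] unfolding B_def by auto
    ultimately show False using id_p_subset greaterThan_notin_id_p by blast
  qed
  then obtain \<eta> where \<eta>: "\<And>\<delta>. \<delta> \<in> T \<Longrightarrow> \<eta> \<delta> < \<delta>" "\<And>\<delta>. \<delta> \<in> T \<Longrightarrow> B \<delta> (\<eta> \<delta>) \<notin> id_p S C I"
    by metis
  \<comment> \<open>A point of \<open>c \<delta>\<close> above \<open>\<eta> \<delta>\<close> lies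
    in the tail for every \<open>\<beta> \<in> B \<delta> (\<eta> \<delta>)\<close> at once.\<close>
  have "\<exists>x. x \<in> c \<delta> \<and> \<eta> \<delta> < x \<and> x < \<delta>" if \<delta>: "\<delta> \<in> T" for \<delta>
  proof -
    obtain y where "\<eta> \<delta> < y" "y < \<delta>" using T(2)[OF \<delta>] \<eta>(1)[OF \<delta>] unfolding limit_ord_def by blast
    then show ?thesis
      using c(1)[OF T(2)[OF \<delta>]] unfolding club_in_def
      by (meson lessThan_iff less_le_trans subsetD)
  qed
  then obtain f where f: "\<And>\<delta>. \<delta> \<in> T \<Longrightarrow> f \<delta> \<in> c \<delta>" "\<And>\<delta>. \<delta> \<in> T \<Longrightarrow> \<eta> \<delta> < f \<delta>"
    "\<And>\<delta>. \<delta> \<in> T \<Longrightarrow> f \<delta> < \<delta>" by metis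
  obtain \<alpha> where "\<forall>b. \<exists>\<delta>\<in>T. f \<delta> = \<alpha> \<and> b \<le> \<delta>"
    using pressing_down_unbounded[OF T(1) f(3)] by blast
  then have "\<forall>b. \<exists>\<delta>\<in>{\<delta>\<in>T. f \<delta> = \<alpha>}. b \<le> \<delta>" by blast
  from unbounded_card[OF this]
  obtain V where V: "V \<subseteq> {\<delta>\<in>T. f \<delta> = \<alpha>}" "|V| =o |{..<\<mu>}|" by blast
  have disj: "\<not> \<delta> < \<delta>'" if "\<delta> \<in> V" "\<delta>' \<in> V" "\<beta> \<in> B \<delta> (\<eta> \<delta>)" "\<beta> \<in> B \<delta>' (\<eta> \<delta>')" for \<delta> \<delta>' \<beta>
  proof
    assume "\<delta> < \<delta>'"
    have T': "\<delta> \<in> T" "\<delta>' \<in> T" "f \<delta> = \<alpha>" "f \<delta>' = \<alpha>" using V that by auto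
    have "\<alpha> \<in> c \<delta>" "\<alpha> \<in> c \<delta>'" "\<eta> \<delta> < \<alpha>" "\<eta> \<delta>' < \<alpha>"
      using f(1,2)[OF T'(1)] f(1,2)[OF T'(2)] T'(3,4) by simp_all
    moreover have "F \<beta> \<delta> \<le> \<eta> \<delta>" "F \<beta> \<delta>' \<le> \<eta> \<delta>'" "\<delta>' < \<beta>"
      using that unfolding B_def by simp_all
    \<comment> \<open>The common value \<open>\<alpha>\<close> lies in both tails given by the same
      function \<open>F \<beta>\<close>, which their disjointness forbids.\<close>
    ultimately have "F \<beta> \<delta> < \<alpha>" "F \<beta> \<delta>' < \<alpha>" by order+
    moreover have "\<alpha> \<le> F \<beta> \<delta>'"
      by (rule tails_disjointD[OF F[of \<beta>] T'(1,2)]) fact+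
    ultimately show False by order
  qed
  have "\<not> weakly_saturated \<mu> UNIV (id_p S C I)"
  proof (rule disjoint_positive_not_saturated[OF V(2), of "\<lambda>\<delta>. B \<delta> (\<eta> \<delta>)"])
    show "B \<delta> (\<eta> \<delta>) \<notin> id_p S C I" if "\<delta> \<in> V" for \<delta> using that V \<eta>(2) by blast
    show "\<delta> = \<delta>'" if "\<delta> \<in> V" "\<delta>' \<in> V" "x \<in> B \<delta> (\<eta> \<delta>)" "x \<in> B \<delta>' (\<eta> \<delta>')" for \<delta> \<delta>' x
      using disj[of \<delta> \<delta>' x] disj[of \<delta>' \<delta> x] that by force
  qed
  then show False using assms(7) by contradiction
qed

end
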